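(* Consider a GSWF on three alternatives with $n\ge1$ voters satisfying the IIA condition. If the individual preferences are independent and uniformly distributed over the six linear orderings of the alternatives, and the GSWF is monotone and balanced, then the probability of a rational choice is at least $3/4$.
   Context: There are $n$ voters and three alternatives $A,B,C$. Each voter gives a strict linear ordering of the alternatives; a profile is the collection of the $n$ orderings. Voter $i$'s ordering is encoded by $(x_i,y_i,z_i)\in\{0,1\}^3\setminus\{(0,0,0),(1,1,1)\}$, where $x_i=1$ iff voter $i$ prefers $A$ to $B$, $y_i=1$ iff voter $i$ prefers $B$ to $C$, and $z_i=1$ iff voter $i$ prefers $C$ to $A$. A generalized social welfare function (GSWF) assigns to each profile a preference of the society on each of the three pairs of alternatives (not necessarily transitive). It satisfies Independence of Irrelevant Alternatives (IIA) if the society's preference on each pair depends only on the individual preferences on that pair; so it is given by choice functions $f,g,h:\{0,1\}^n\to\{0,1\}$: society prefers $A$ to $B$ iff $f(x)=1$, $B$ to $C$ iff $g(y)=1$, and $C$ to $A$ iff $h(z)=1$. The choice of the society is irrational for a profile if $f(x)=g(y)=h(z)=1$ or $f(x)=g(y)=h(z)=0$ (no linear ordering results), and rational otherwise. The GSWF is balanced if $\mathbb{E}[f]=\mathbb{E}[g]=\mathbb{E}[h]=1/2$ with respect to the uniform measure on $\{0,1\}^n$. It is monotone if $f,g,h$ are monotone increasing, where $f$ is monotone increasing if $f(x)\le f(y)$ whenever $x_i\le y_i$ for all $i$. *)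

theory Defs
  imports "HOL-Probability.Probability"
begin

datatype alternative = A | B | C

text \<open>
  A preference is a relation on the alternatives, where \<open>(a, b) \<in> r\<close> means that
  \<open>a\<close> is preferred to \<open>b\<close>.
  The voters are the elements of a finite type, so there is at least one voter.
\<close>

definition orderings :: "alternative rel set" where
  "orderings = {r. strict_linear_order r}"

definition profiles :: "('v::finite \<Rightarrow> alternative rel) set" where
  "profiles = {p. \<forall>i. p i \<in> orderings}"

text \<open>
  The value of a GSWF is a preference on each of the three pairs, i.e. for \<open>a \<noteq> b\<close>
  exactly one of \<open>a\<close>, \<open>b\<close> is preferred to the other; transitivity is not required.
  Only the values on \<open>profiles\<close> are relevant.
\<close>

definition gswf :: "(('v::finite \<Rightarrow> alternative rel) \<Rightarrow> alternative rel) \<Rightarrow> bool" where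
  "gswf F \<longleftrightarrow> (\<forall>p\<in>profiles. asym (F p) \<and> total (F p))"

definition IIA :: "(('v::finite \<Rightarrow> alternative rel) \<Rightarrow> alternative rel) \<Rightarrow> bool" where
  "IIA F \<longleftrightarrow> (\<forall>a b. a \<noteq> b \<longrightarrow> (\<forall>p\<in>profiles. \<forall>q\<in>profiles.
     (\<forall>i. (a, b) \<in> p i \<longleftrightarrow> (a, b) \<in> q i) \<longrightarrow> ((a, b) \<in> F p \<longleftrightarrow> (a, b) \<in> F q)))"

text \<open>
  \<open>pref_vector a b p\<close> is the vector in \<open>{0,1}\<^sup>n\<close> recording which voters prefer \<open>a\<close> to \<open>b\<close>;
  with \<open>bool\<close> in place of \<open>{0,1}\<close>, the vectors \<open>x\<close>, \<open>y\<close>, \<open>z\<close> of a profile are obtained for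
  the pairs \<open>(A, B)\<close>, \<open>(B, C)\<close>, \<open>(C, A)\<close>.
\<close>

definition pref_vector ::
    "alternative \<Rightarrow> alternative \<Rightarrow> ('v::finite \<Rightarrow> alternative rel) \<Rightarrow> 'v \<Rightarrow> bool" where
  "pref_vector a b p = (\<lambda>i. (a, b) \<in> p i)"

text \<open>
  The choice function on the pair \<open>(a, b)\<close>. Every vector is the preference vector of some
  profile, and under IIA the choice of that profile is immaterial: see the lemmas
  \<open>ex_profile_pref_vector\<close>, \<open>choice_pref_vector\<close> and \<open>choice_unique\<close> below.
\<close>

definition choice_fun ::
    "(('v::finite \<Rightarrow> alternative rel) \<Rightarrow> alternative rel) \<Rightarrow> alternative \<Rightarrow> alternative \<Rightarrow>
     ('v \<Rightarrow> bool) \<Rightarrow> bool" where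
  "choice_fun F a b v \<longleftrightarrow> (\<exists>p\<in>profiles. pref_vector a b p = v \<and> (a, b) \<in> F p)"

definition irrational :: "(('v::finite \<Rightarrow> alternative rel) \<Rightarrow> alternative rel) \<Rightarrow>
    ('v \<Rightarrow> alternative rel) \<Rightarrow> bool" where
  "irrational F p \<longleftrightarrow>
     (let f = choice_fun F A B (pref_vector A B p);
          g = choice_fun F B C (pref_vector B C p);
          h = choice_fun F C A (pref_vector C A p)
      in (f \<and> g \<and> h) \<or> (\<not> f \<and> \<not> g \<and> \<not> h))"

definition balanced :: "(('v::finite \<Rightarrow> alternative rel) \<Rightarrow> alternative rel) \<Rightarrow> bool" where
  "balanced F \<longleftrightarrow> (\<forall>(a, b) \<in> {(A, B), (B, C), (C, A)}.
     measure_pmf.expectation (pmf_of_set UNIV) (\<lambda>v. of_bool (choice_fun F a b v) :: real) = 1 / 2)"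

text \<open>The order on \<open>'v \<Rightarrow> bool\<close> is pointwise, with \<open>False < True\<close>.\<close>

definition monotone_gswf :: "(('v::finite \<Rightarrow> alternative rel) \<Rightarrow> alternative rel) \<Rightarrow> bool" where
  "monotone_gswf F \<longleftrightarrow>
     mono (choice_fun F A B) \<and> mono (choice_fun F B C) \<and> mono (choice_fun F C A)"

text \<open>
  Independent uniformly distributed orderings of the voters; the default value of
  \<open>Pi_pmf\<close> is irrelevant because the index set is \<open>UNIV\<close>.
\<close>

definition profile_pmf :: "('v::finite \<Rightarrow> alternative rel) pmf" where
  "profile_pmf = Pi_pmf UNIV {} (\<lambda>_. pmf_of_set orderings)"


lemma UNIV_alternative: "UNIV = {A, B, C}"
  using alternative.exhaust by auto

instance alternative :: finite
  by standard (simp add: UNIV_alternative)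

lemma all_alternative: "(\<forall>a. P a) \<longleftrightarrow> P A \<and> P B \<and> P C"
  by (metis alternative.exhaust)

lemma orderings_eq:
  "orderings = {{(A,B),(B,C),(A,C)}, {(A,C),(C,B),(A,B)}, {(B,A),(A,C),(B,C)},
                {(B,C),(C,A),(B,A)}, {(C,A),(A,B),(C,B)}, {(C,B),(B,A),(C,A)}}"
    (is "_ = ?R")
proof -
  have eq: "r = s \<longleftrightarrow> (\<forall>a b. (a, b) \<in> r \<longleftrightarrow> (a, b) \<in> s)" for r s :: "alternative rel"
    by auto
  have "r \<in> ?R" if r: "r \<in> orderings" for r
  proof -
    have "trans r" "irrefl r" "total r"
      using r by (simp_all add: orderings_def strict_linear_order_on_def)
    then have trans: "\<And>a b c. (a, b) \<in> r \<Longrightarrow> (b, c) \<in> r \<Longrightarrow> (a, c) \<in> r"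
      and irr: "\<And>a. (a, a) \<notin> r"
      and total: "\<And>a b. a \<noteq> b \<Longrightarrow> (a, b) \<in> r \<or> (b, a) \<in> r"
      by (blast dest: transD, blast dest: irreflD, simp add: total_on_def)
    have asym: "(a, b) \<in> r \<Longrightarrow> (b, a) \<notin> r" for a b
      using trans[of a b a] irr[of a] by blast
    have tot: "(B, A) \<in> r \<longleftrightarrow> (A, B) \<notin> r" "(C, B) \<in> r \<longleftrightarrow> (B, C) \<notin> r"
        "(A, C) \<in> r \<longleftrightarrow> (C, A) \<notin> r"
      using asym[of A B] total[of A B] asym[of B C] total[of B C] asym[of C A] total[of C A]
      by auto
    have "(A, B) \<in> r \<longrightarrow> (B, C) \<in> r \<longrightarrow> (A, C) \<in> r"
         "(C, B) \<in> r \<longrightarrow> (B, A) \<in> r \<longrightarrow> (C, A) \<in> r"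
      using trans[of A B C] trans[of C B A] by blast+
    then show ?thesis
      unfolding insert_iff empty_iff eq all_alternative using irr tot
      by (cases "(A, B) \<in> r"; cases "(B, C) \<in> r"; cases "(C, A) \<in> r") simp_all
  qed
  moreover have "r \<in> orderings" if "r \<in> ?R" for r
    using that by (elim insertE emptyE) 
      (simp_all add: orderings_def strict_linear_order_on_def trans_def irrefl_def total_on_def
        all_alternative)
  ultimately show ?thesis
    by (intro subset_antisym subsetI)
qed

lemma card_orderings: "card orderings = 6"
  unfolding orderings_eq by (simp add: set_eq_iff split_paired_All all_alternative)

lemma ex_profile_pref_vector:
  assumes "a \<noteq> b"
  shows "\<exists>p\<in>profiles. pref_vector a b p = v"
proof -
  have *: "\<exists>r\<in>orderings. (a, b) \<in> r \<longleftrightarrow> w" for w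
    using assms by (cases a; cases b; cases w) (simp_all add: orderings_eq)
  then obtain r where "r w \<in> orderings" "(a, b) \<in> r w \<longleftrightarrow> w" for w
    by metis
  then show ?thesis
    by (intro bexI[of _ "\<lambda>i. r (v i)"]) (auto simp: profiles_def pref_vector_def)
qed

lemma choice_pref_vector:
  assumes "IIA F" "p \<in> profiles" "a \<noteq> b"
  shows "choice_fun F a b (pref_vector a b p) \<longleftrightarrow> (a, b) \<in> F p"
proof
  assume "choice_fun F a b (pref_vector a b p)"
  then obtain q where "q \<in> profiles" "pref_vector a b q = pref_vector a b p" "(a, b) \<in> F q"
    by (auto simp: choice_fun_def)
  moreover from this(2) have "\<forall>i. (a, b) \<in> q i \<longleftrightarrow> (a, b) \<in> p i"
    by (simp add: pref_vector_def fun_eq_iff)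
  ultimately show "(a, b) \<in> F p"
    using assms unfolding IIA_def by blast
next
  assume "(a, b) \<in> F p"
  with assms(2) show "choice_fun F a b (pref_vector a b p)"
    by (auto simp: choice_fun_def)
qed

lemma choice_unique:
  fixes F :: "('v::finite \<Rightarrow> alternative rel) \<Rightarrow> alternative rel"
  assumes "IIA F" "a \<noteq> b" "\<And>p. p \<in> profiles \<Longrightarrow> f (pref_vector a b p) \<longleftrightarrow> (a, b) \<in> F p"
  shows "f = choice_fun F a b"
proof
  fix v :: "'v \<Rightarrow> bool"
  obtain p where "p \<in> profiles" "pref_vector a b p = v"
    using ex_profile_pref_vector[OF assms(2)] by blast
  then show "f v = choice_fun F a b v"
    using assms choice_pref_vector by metis
qed

lemma irrational_iff:
  assumes "gswf F" "IIA F" "p \<in> profiles"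
  shows "irrational F p \<longleftrightarrow> \<not> strict_linear_order (F p)"
proof -
  have as: "asym (F p)" and to: "total (F p)"
    using assms by (auto simp: gswf_def)
  have asym: "(a, b) \<in> F p \<Longrightarrow> (b, a) \<notin> F p" for a b
    using as by (rule asymD)
  have total: "a \<noteq> b \<Longrightarrow> (a, b) \<in> F p \<or> (b, a) \<in> F p" for a b
    using to by (simp add: total_on_def)
  have irr: "(a, a) \<notin> F p" for a
    using asym[of a a] by blast
  have tot: "(B, A) \<in> F p \<longleftrightarrow> (A, B) \<notin> F p" "(C, B) \<in> F p \<longleftrightarrow> (B, C) \<notin> F p"
    "(A, C) \<in> F p \<longleftrightarrow> (C, A) \<notin> F p"
    using asym[of A B] total[of A B] asym[of B C] total[of B C] asym[of C A] total[of C A]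
    by auto
  have "strict_linear_order (F p) \<longleftrightarrow> trans (F p)"
    using irr to by (simp add: strict_linear_order_on_def irrefl_def)
  also have "\<dots> \<longleftrightarrow> \<not> irrational F p"
    unfolding irrational_def Let_def trans_def all_alternative using assms(2,3) irr tot
    by (cases "(A, B) \<in> F p"; cases "(B, C) \<in> F p"; cases "(C, A) \<in> F p")
       (simp_all add: choice_pref_vector)
  finally show ?thesis by blast
qed

lemma set_profile_pmf: "set_pmf profile_pmf = profiles"
proof -
  have "finite orderings" "orderings \<noteq> {}"
    using card_orderings by (auto intro: card_ge_0_finite)
  then show ?thesis
    by (auto simp: profile_pmf_def profiles_def set_Pi_pmf PiE_dflt_def)
qed

end

theory Submission
  imports Defs
begin

text \<open>
  On \<open>{0,1}\<close>-valued choices the indicator of an irrational outcome equals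
  \<open>1 - f - g - h + f g + g h + h f\<close>. For a single voter any two of the coordinates
  \<open>x\<^sub>i, y\<^sub>i, z\<^sub>i\<close> are negatively correlated, and by induction on the number of voters
  monotone functions of \<open>x\<close> and of \<open>y\<close> are then negatively correlated as well. So in the
  balanced case each product has expectation at most \<open>1/4\<close>, and an irrational outcome has
  probability at most \<open>1 - 3/2 + 3/4 = 1/4\<close>.
\<close>

text \<open>Every real function of a bit is affine, so the covariance of \<open>f (X r)\<close> and
  \<open>g (Y r)\<close> is the covariance of the two bits times the product of the slopes.
  Monotonicity makes both slopes nonnegative, hence the sign assumed in \<open>corr\<close> is
  preserved.\<close>

lemma expectation_bool_negatively_correlated:
  fixes M :: "'a::finite pmf" and f g :: "bool \<Rightarrow> real"
  assumes corr: "measure_pmf.prob M {r. X r \<and> Y r} \<le>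
      measure_pmf.prob M {r. X r} * measure_pmf.prob M {r. Y r}"
    and f: "mono f" and g: "mono g"
  shows "measure_pmf.expectation M (\<lambda>r. f (X r) * g (Y r)) \<le>
    measure_pmf.expectation M (\<lambda>r. f (X r)) * measure_pmf.expectation M (\<lambda>r. g (Y r))"
proof -
  let ?E = "measure_pmf.expectation M" and ?P = "\<lambda>Z. measure_pmf.prob M {r. Z r}"
  have [simp]: "integrable (measure_pmf M) u" for u :: "'a \<Rightarrow> real"
    by (simp add: integrable_measure_pmf_finite)
  have ind: "?E (\<lambda>r. of_bool (Z r)) = ?P Z" for Z
  proof -
    have "(\<lambda>r. of_bool (Z r)) = (indicat_real {r. Z r})"
      by (auto simp: fun_eq_iff)
    then show ?thesis
      by simp
  qed
  define a b where "a = f True - f False" and "b = g True - g False"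
  have fX: "f v = f False + a * of_bool v" and gY: "g v = g False + b * of_bool v" for v
    by (cases v; simp add: a_def b_def)+
  have "f (X r) * g (Y r) = f False * g False + f False * b * of_bool (Y r) +
      a * g False * of_bool (X r) + a * b * of_bool (X r \<and> Y r)" for r
    by (subst fX, subst gY) (simp add: algebra_simps)
  then have E: "?E (\<lambda>r. f (X r) * g (Y r)) = f False * g False + f False * b * ?P Y +
      a * g False * ?P X + a * b * ?P (\<lambda>r. X r \<and> Y r)"
    by (simp add: ind del: of_bool_conj)
  have EX: "?E (\<lambda>r. f (X r)) = f False + a * ?P X"
    by (subst fX) (simp add: ind)
  have EY: "?E (\<lambda>r. g (Y r)) = g False + b * ?P Y"
    by (subst gY) (simp add: ind)
  have "0 \<le> a * b"
    using monoD[OF f, of False True] monoD[OF g, of False True] by (simp add: a_def b_def)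
  then have "a * b * ?P (\<lambda>r. X r \<and> Y r) \<le> a * b * (?P X * ?P Y)"
    using corr by (rule mult_left_mono[rotated])
  then show ?thesis
    by (simp add: E EX EY algebra_simps)
qed

text \<open>Fubini for splitting one independent coordinate off the product; it drives the induction
  on the set of voters below.\<close>

lemma expectation_Pi_pmf_insert:
  fixes M :: "'v::finite \<Rightarrow> 'a::finite pmf" and u :: "('v \<Rightarrow> 'a) \<Rightarrow> real"
  assumes "i \<notin> I"
  shows "measure_pmf.expectation (Pi_pmf (insert i I) d M) u =
    measure_pmf.expectation (M i)
      (\<lambda>r. measure_pmf.expectation (Pi_pmf I d M) (\<lambda>p. u (p(i := r))))"
proof -
  have "Pi_pmf (insert i I) d M =
      bind_pmf (M i) (\<lambda>r. map_pmf (\<lambda>p. p(i := r)) (Pi_pmf I d M))"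
    using assms by (subst Pi_pmf_insert') (simp_all add: map_pmf_def)
  then show ?thesis
    by (simp add: pmf_expectation_bind[where A = UNIV] integral_measure_pmf[of UNIV "M i"])
qed

text \<open>A Harris-type inequality: negative correlation in each coordinate passes to increasing
  functions of independent coordinates. The induction is over arbitrary \<open>f\<close> and
  \<open>g\<close> because its hypothesis is applied to their sections with one entry fixed.\<close>

lemma expectation_Pi_pmf_negatively_correlated:
  fixes M :: "'v::finite \<Rightarrow> 'a::finite pmf" and f g :: "('v \<Rightarrow> bool) \<Rightarrow> real"
  assumes corr: "\<And>i. measure_pmf.prob (M i) {r. X r \<and> Y r} \<le>
      measure_pmf.prob (M i) {r. X r} * measure_pmf.prob (M i) {r. Y r}"
    and "mono f" "mono g"
  shows "measure_pmf.expectation (Pi_pmf I d M) (\<lambda>p. f (\<lambda>i. X (p i)) * g (\<lambda>i. Y (p i))) \<le>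
    measure_pmf.expectation (Pi_pmf I d M) (\<lambda>p. f (\<lambda>i. X (p i))) *
    measure_pmf.expectation (Pi_pmf I d M) (\<lambda>p. g (\<lambda>i. Y (p i)))"
proof -
  have "finite I" by simp
  then show ?thesis
    using assms(2,3)
  proof (induction I arbitrary: f g)
    case empty
    then show ?case by simp
  next
    case (insert i I)
    let ?E = "measure_pmf.expectation (Pi_pmf I d M)"
    have upd: "(\<lambda>j. Z ((p(i := r)) j)) = (\<lambda>j. Z (p j))(i := Z r)"
      for Z :: "'a \<Rightarrow> bool" and p :: "'v \<Rightarrow> 'a" and r
      by auto
    have mono_upd: "mono (\<lambda>v. u (v(i := b)))" if "mono u"
      for u :: "('v \<Rightarrow> bool) \<Rightarrow> real" and b
      by (intro monoI monoD[OF that]) (simp add: le_fun_def)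
    have mono_E: "mono (\<lambda>b. ?E (\<lambda>p. u ((\<lambda>j. Z (p j))(i := b))))" if "mono u"
      for u :: "('v \<Rightarrow> bool) \<Rightarrow> real" and Z
      by (intro monoI integral_mono integrable_measure_pmf_finite monoD[OF that])
        (simp_all add: le_fun_def)
    have "measure_pmf.expectation (Pi_pmf (insert i I) d M)
        (\<lambda>p. f (\<lambda>i. X (p i)) * g (\<lambda>i. Y (p i))) =
      measure_pmf.expectation (M i) (\<lambda>r. ?E (\<lambda>p. f ((\<lambda>j. X (p j))(i := X r)) *
        g ((\<lambda>j. Y (p j))(i := Y r))))"
      by (simp only: expectation_Pi_pmf_insert[OF insert.hyps(2)] upd[of X] upd[of Y])
    \<comment> \<open>For each fixed \<open>r\<close>, the induction hypothesis applies to the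
      sections of \<open>f\<close> at \<open>X r\<close> and of \<open>g\<close> at
      \<open>Y r\<close>, which are increasing by \<open>mono_upd\<close>.\<close>
    also have "\<dots> \<le> measure_pmf.expectation (M i) (\<lambda>r. ?E (\<lambda>p. f ((\<lambda>j. X (p j))(i := X r))) *
        ?E (\<lambda>p. g ((\<lambda>j. Y (p j))(i := Y r))))"
      by (intro integral_mono integrable_measure_pmf_finite insert.IH mono_upd insert.prems)
        simp_all
    \<comment> \<open>By \<open>mono_E\<close> the inner expectations are increasing functions of
      the single bits \<open>X r\<close> and \<open>Y r\<close>, so averaging over \<open>r\<close>
      is an instance of the one-coordinate inequality.\<close>
    also have "\<dots> \<le>
        measure_pmf.expectation (M i) (\<lambda>r. ?E (\<lambda>p. f ((\<lambda>j. X (p j))(i := X r)))) *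
        measure_pmf.expectation (M i) (\<lambda>r. ?E (\<lambda>p. g ((\<lambda>j. Y (p j))(i := Y r))))"
      by (rule expectation_bool_negatively_correlated[OF corr mono_E mono_E])
        (fact insert.prems)+
    also have "\<dots> =
        measure_pmf.expectation (Pi_pmf (insert i I) d M) (\<lambda>p. f (\<lambda>i. X (p i))) *
        measure_pmf.expectation (Pi_pmf (insert i I) d M) (\<lambda>p. g (\<lambda>i. Y (p i)))"
      by (simp only: expectation_Pi_pmf_insert[OF insert.hyps(2)] upd[of X] upd[of Y])
    finally show ?case .
  qed
qed

lemma prob_orderings:
  "measure_pmf.prob (pmf_of_set orderings) {r. P r} = card {r \<in> orderings. P r} / 6"
  using card_orderings
  by (subst measure_pmf_of_set) (auto intro: card_ge_0_finite simp: Collect_conj_eq)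

lemma prob_pref:
  assumes "a \<noteq> b"
  shows "measure_pmf.prob (pmf_of_set orderings) {r. (a, b) \<in> r} = 1 / 2"
proof -
  have "{r \<in> orderings. (a, b) \<in> r} = orderings \<inter> {r. (a, b) \<in> r}"
    by auto
  also have "card \<dots> = 3"
    using assms unfolding orderings_eq
    by (cases a; cases b; simp add: Int_insert_left; simp add: set_eq_iff split_paired_All all_alternative)
  finally show ?thesis
    by (simp add: prob_orderings)
qed

text \<open>By transitivity only the ordering with \<open>a\<close> first, \<open>b\<close> second
  and \<open>c\<close> last qualifies. Independent bits would give 1/4, so this value is the source
  of the negative correlation.\<close>

lemma prob_cyclic_pref:
  assumes "(a, b, c) \<in> {(A, B, C), (B, C, A), (C, A, B)}"
  shows "measure_pmf.prob (pmf_of_set orderings) {r. (a, b) \<in> r \<and> (b, c) \<in> r} = 1 / 6"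
proof -
  have "{r \<in> orderings. (a, b) \<in> r \<and> (b, c) \<in> r} = {{(a, b), (b, c), (a, c)}}"
    using assms unfolding orderings_eq by auto
  then show ?thesis
    by (simp add: prob_orderings)
qed

text \<open>Balance is stated for uniform vectors, whereas the theorem samples profiles; this lemma
  connects the two. Each voter's bit is fair and the voters are independent.\<close>

lemma map_pref_vector_profile_pmf:
  assumes "a \<noteq> b"
  shows "map_pmf (pref_vector a b) profile_pmf = pmf_of_set (UNIV :: ('v::finite \<Rightarrow> bool) set)"
proof -
  have pmf: "map_pmf (\<lambda>r. (a, b) \<in> r) (pmf_of_set orderings) = pmf_of_set UNIV"
  proof (rule pmf_eqI)
    fix v
    have "measure_pmf.prob (pmf_of_set orderings) {r. (a, b) \<notin> r} = 1 / 2"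
      using measure_pmf.prob_compl[of "{r. (a, b) \<in> r}" "pmf_of_set orderings"] prob_pref[OF assms]
      by (simp add: Compl_eq_Diff_UNIV[symmetric] Collect_neg_eq)
    then show "pmf (map_pmf (\<lambda>r. (a, b) \<in> r) (pmf_of_set orderings)) v = pmf (pmf_of_set UNIV) v"
      using prob_pref[OF assms] by (cases v) (simp_all add: pmf_map vimage_def)
  qed
  have "map_pmf (pref_vector a b) profile_pmf =
      map_pmf (\<lambda>p. (\<lambda>r. (a, b) \<in> r) \<circ> p) (Pi_pmf (UNIV :: 'v set) {} (\<lambda>_. pmf_of_set orderings))"
    by (simp add: profile_pmf_def pref_vector_def[abs_def] comp_def)
  \<comment> \<open>The default becomes \<open>False\<close> because \<open>Pi_pmf_map\<close> needs
    the image of the old default, and \<open>(a, b)\<close> is not in \<open>{}\<close>.\<close>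
  also have "\<dots> = Pi_pmf UNIV False (\<lambda>_. pmf_of_set UNIV)"
    by (subst Pi_pmf_map[symmetric]) (simp_all add: pmf)
  also have "\<dots> = pmf_of_set UNIV"
    by (subst Pi_pmf_of_set) (auto simp: PiE_dflt_def)
  finally show ?thesis .
qed

lemma expectation_pref_vector_negatively_correlated:
  fixes f g :: "('v::finite \<Rightarrow> bool) \<Rightarrow> real"
  assumes "(a, b, c) \<in> {(A, B, C), (B, C, A), (C, A, B)}" and "mono f" "mono g"
  shows "measure_pmf.expectation profile_pmf (\<lambda>p. f (pref_vector a b p) * g (pref_vector b c p)) \<le>
    measure_pmf.expectation profile_pmf (\<lambda>p. f (pref_vector a b p)) *
    measure_pmf.expectation profile_pmf (\<lambda>p. g (pref_vector b c p))"
proof -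
  have "a \<noteq> b" "b \<noteq> c"
    using assms(1) by auto
  \<comment> \<open>The hypothesis on a single voter amounts to 1/6 \<le> 1/2 * 1/2.\<close>
  then show ?thesis
    unfolding profile_pmf_def pref_vector_def
    by (intro expectation_Pi_pmf_negatively_correlated assms(2,3))
      (simp add: prob_cyclic_pref[OF assms(1)] prob_pref)
qed

theorem theorem1p2:
  fixes F :: "('v::finite \<Rightarrow> alternative rel) \<Rightarrow> alternative rel"
  assumes "gswf F" and "IIA F"
    and "monotone_gswf F" and "balanced F"
  shows "measure_pmf.prob profile_pmf {p. \<not> irrational F p} \<ge> 3 / 4"
proof -
  let ?E = "measure_pmf.expectation (profile_pmf :: ('v \<Rightarrow> alternative rel) pmf)"
  define u :: "alternative \<Rightarrow> alternative \<Rightarrow> ('v \<Rightarrow> bool) \<Rightarrow> real"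
    where "u a b v = of_bool (choice_fun F a b v)" for a b v
  define U where "U a b p = u a b (pref_vector a b p)" for a b p
  \<comment> \<open>Triples instead of pairs: rotating \<open>(a, b, c)\<close> yields the next pair
    \<open>(b, c)\<close> of the cycle, as used for \<open>quarter\<close>.\<close>
  let ?cyc = "{(A, B, C), (B, C, A), (C, A, B)}"
  have mono: "mono (u a b)" if "(a, b, c) \<in> ?cyc" for a b c
    using assms(3) that by (auto simp: monotone_gswf_def mono_def u_def le_bool_def)
  have half: "?E (U a b) = 1 / 2" if "(a, b, c) \<in> ?cyc" for a b c
  proof -
    have "?E (U a b) = measure_pmf.expectation (map_pmf (pref_vector a b) profile_pmf) (u a b)"
      by (simp add: U_def[abs_def])
    also have "\<dots> = 1 / 2"
      using assms(4) that unfolding balanced_def u_def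
      by (subst map_pref_vector_profile_pmf) auto
    finally show ?thesis .
  qed
  have quarter: "?E (\<lambda>p. U a b p * U b c p) \<le> 1 / 4" if "(a, b, c) \<in> ?cyc" for a b c
  proof -
    have cyc': "(b, c, a) \<in> ?cyc"
      using that by auto
    have "?E (\<lambda>p. U a b p * U b c p) \<le> ?E (U a b) * ?E (U b c)"
      using expectation_pref_vector_negatively_correlated[OF that mono[OF that] mono[OF cyc']]
      by (simp add: U_def[abs_def])
    also have "\<dots> = 1 / 4"
      by (simp add: half[OF that] half[OF cyc'])
    finally show ?thesis .
  qed
  have [simp]: "integrable (measure_pmf profile_pmf) w" for w :: "('v \<Rightarrow> alternative rel) \<Rightarrow> real"
    by (simp add: integrable_measure_pmf_finite)
  \<comment> \<open>With f, g, h for the three choices, irrationality has indicator f g h + (1 - f)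
    (1 - g) (1 - h). The cubic terms cancel, which is why bounds on pairwise products
    suffice.\<close>
  have ind: "indicat_real {p. \<not> irrational F p} =
      (\<lambda>p. U A B p + U B C p + U C A p -
        (U A B p * U B C p + U B C p * U C A p + U C A p * U A B p))"
    by (auto simp: fun_eq_iff indicator_def irrational_def Let_def U_def u_def)
  have "measure_pmf.prob profile_pmf {p. \<not> irrational F p} =
      ?E (indicat_real {p. \<not> irrational F p})"
    by simp
  also have "\<dots> = 3 / 2 -
      (?E (\<lambda>p. U A B p * U B C p) + ?E (\<lambda>p. U B C p * U C A p) + ?E (\<lambda>p. U C A p * U A B p))"
    using half[of A B C] half[of B C A] half[of C A B] unfolding ind by simp
  also have "\<dots> \<ge> 3 / 4"
    using quarter[of A B C] quarter[of B C A] quarter[of C A B] by simp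
  finally show ?thesis .
qed

end
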